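(* Let $\delta^->0$, and consider the improving two-task instance described in the context, with current agent $A_k$, failure rate $Z_k$ and remaining gap $u_k=1-J_{\mathrm{user}}(A_k)$. Fix $Z_k\in(0,1)$ and the total risk allocation. One can choose $m,n_F,n_R$, each of order $\widetilde O(u_k^{-2})$, such that Measured-margin validation (with allowed retained-task decrease $\delta^-$) validates the modification whenever the prescribed samples are ready and the joint error bounds hold. Here $m$ is the rollout count per agent per task, $n_F$ the returned failure-task count, and $n_R$ the stored-record count.
   Context: **Notation.** $V(A,t)$ is the expected reward of agent $A$ on task $t$ (rewards in $[0,1]$), and $J_{\mathrm{user}}(A)$ is the expectation of $V(A,t)$ over $t\sim\mathcal D_{\mathrm{user}}$. A binary detector $\phi(t,o)$ marks failed outputs; $\psi_{A_k}(t)$ is the probability that $A_k$ fails on $t$, and $Z_k=\mathbb E_{\mathcal D_{\mathrm{user}}}[\psi_{A_k}]$. The failure-task and retained-task distributions $\mathcal D_{F,k},\mathcal D_{R,k}$ have densities $\psi_{A_k}/Z_k$ and $(1-\psi_{A_k})/(1-Z_k)$ with respect to $\mathcal D_{\mathrm{user}}$. A modification $c$ of the agent's harness gives the candidate agent $\widetilde A=A_k\oplus c$. Put $L=Z_k\,\mathbb E_{\mathcal D_{F,k}}[V(\widetilde A,t)-V(A_k,t)]$ and $D_R^-=\mathbb E_{\mathcal D_{R,k}}[(V(A_k,t)-V(\widetilde A,t))_+]$. **Improving two-task instance.** For $Z\in(0,1)$ and $0<u\le\min\{Z/2,(1-Z)\delta^-\}$: tasks $\{t_F,t_R\}$ with $\mathcal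 D_{\mathrm{user}}=Z\delta_{t_F}+(1-Z)\delta_{t_R}$; outputs $\{0,1\}$; reward $r(t,o)=o$; $\phi(t_F,\cdot)=1$, $\phi(t_R,\cdot)=0$. On $t_F$, $A_k$ outputs $\mathrm{Bernoulli}(1-u/Z)$ and $\widetilde A$ outputs $\mathrm{Bernoulli}(1-u/(2Z))$; on $t_R$ both output $1$ deterministically. Thus $Z_k=Z$, $u_k=1-J_{\mathrm{user}}(A_k)=u$, $J_{\mathrm{user}}(A_k)\ge1-(1-Z)\delta^-$, $L=u/2$ and $D_R^-=0$. **Evaluation data.** (a) A stored sample of $n_R$ task records $(t_j^R,\phi_j^R)$ labeled by $A_k$, separate from the data used to generate the modification. The joint law of the pre-evaluation information (agents, generation information) and the records is within total variation $2n_R\beta(\ell)$ of a reference law with the same marginal for that information under which, conditionally on it, the tasks are i.i.d. from $\mathcal D_{\mathrm{user}}$ and the labels are independent $\mathrm{Bernoulli}(\psi_{A_k}(t_j^R))$. Here $\beta(\ell)\ge0$ is the $\beta$-mixing coefficient of the stationary user-task stream at spacing $\ell$ (zero for independent tasks), and $2n_R\beta(\ell)<\min\{\beta_Z,\beta_R\}$. (b) A phase with a finite horizon that either returns $n_F$ failure-marked tasks $t_i^F$ or returns nothing, with a radius $\varepsilon_F$ frozen beforehand such that the probability that a batch is returned and $\frac1{n_F}\sum_i[V(\widetilde A,t_i^F)-V(A_k,t_i^F)]$ differs from its expectation under $\mathcal D_{F,k}$ by more than $\varepsilon_F$ is at most $\beta_F$. (c) For each evaluation task $t$ and each agent $A\in\{A_k,\widetilde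 A\}$, $\hat V(A,t)$ is the mean reward of $m$ fresh i.i.d. rollouts, with independent groups of rollouts for the two agents. The sampling design realizing (a) and (b) is part of the evaluation design being chosen. "Ready" means that the stored sample is available with $S_R=\{j:\phi_j^R=0\}$ nonempty and the failure batch was returned. **Estimates.** $\widehat Z_k=\frac1{n_R}\sum_j\phi_j^R$; $\widehat L_k=\widehat Z_k\frac1{n_F}\sum_i[\hat V(\widetilde A,t_i^F)-\hat V(A_k,t_i^F)]$; $\widehat D^-_{R,k}=\frac1{|S_R|}\sum_{j\in S_R}(\hat V(A_k,t_j^R)-\hat V(\widetilde A,t_j^R))_+$. **Radii and risk allocation.** $\varepsilon_V=\sqrt{\log(2/\beta_V^{(1)})/(2m)}$, where $\beta_V^{(1)}$ is the risk per reward estimate; $\varepsilon_Z=\sqrt{\log(2/\tilde\beta_Z)/(2n_R)}$ and $\varepsilon_R=\sqrt{\log(2/\tilde\beta_R)/(2n_R)}$ with $\tilde\beta_Z=\beta_Z-2n_R\beta(\ell)$, $\tilde\beta_R=\beta_R-2n_R\beta(\ell)$; $\varepsilon_L=\varepsilon_Z+(\widehat Z_k+\varepsilon_Z)(2\varepsilon_V+\varepsilon_F)$; $\varepsilon_D^-=(2\varepsilon_V+\varepsilon_R+\varepsilon_Z)/(1-\widehat Z_k)$. The total risk allocation consists of $\beta_Z,\beta_R,\beta_F$ and the total rollout risk $2(n_F+n_R)\beta_V^{(1)}$. **"Joint error bounds hold"** means: $|\widehat Z_k-Z_k|\le\varepsilon_Z$; $|\hat V(A,t)-V(A,t)|\le\varepsilon_V$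 for both agents on all evaluation tasks; the batch mean of $V(\widetilde A,\cdot)-V(A_k,\cdot)$ over the $t_i^F$ is within $\varepsilon_F$ of its expectation under $\mathcal D_{F,k}$; and $\frac1{n_R}\sum_j(1-\phi_j^R)(V(A_k,t_j^R)-V(\widetilde A,t_j^R))_+$ is within $\varepsilon_R$ of $(1-Z_k)D_R^-$. **Measured-margin validation.** When a valid candidate and the required data are available, validate the modification if and only if $\widehat D^-_{R,k}\le\delta^-$ and $\widehat M_k:=\widehat L_k-\varepsilon_L-(1-\widehat Z_k+\varepsilon_Z)(\widehat D^-_{R,k}+\varepsilon_D^-)>0$. $\widetilde O(u_k^{-2})$ hides logarithmic factors and constants depending on the fixed $Z_k$ and risk allocation. *)

theory Defs
  imports "HOL-Probability.Probability"
begin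

section \<open>Agents, rewards and failure detection\<close>

text \<open>\<open>Current\<close> is the agent \<open>A\<^sub>k\<close>; \<open>Candidate\<close> is the modified agent obtained from it.\<close>

datatype side = Current | Candidate

record ('t, 'o) setting =
  user_dist :: "'t pmf"
  reward :: "'t \<Rightarrow> 'o \<Rightarrow> real"
  detect :: "'t \<Rightarrow> 'o \<Rightarrow> bool"
  agent :: "side \<Rightarrow> 't \<Rightarrow> 'o pmf"

definition V :: "('t, 'o) setting \<Rightarrow> side \<Rightarrow> 't \<Rightarrow> real" where
  "V X a t = measure_pmf.expectation (agent X a t) (reward X t)"

definition J_user :: "('t, 'o) setting \<Rightarrow> side \<Rightarrow> real" where
  "J_user X a = measure_pmf.expectation (user_dist X) (V X a)"

definition remaining_gap :: "('t, 'o) setting \<Rightarrow> real" where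
  "remaining_gap X = 1 - J_user X Current"

definition fail_prob :: "('t, 'o) setting \<Rightarrow> 't \<Rightarrow> real" where
  "fail_prob X t = measure_pmf.prob (agent X Current t) {out. detect X t out}"

definition failure_rate :: "('t, 'o) setting \<Rightarrow> real" where
  "failure_rate X = measure_pmf.expectation (user_dist X) (fail_prob X)"

definition failure_dist :: "('t, 'o) setting \<Rightarrow> 't measure" where
  "failure_dist X =
     density (measure_pmf (user_dist X)) (\<lambda>t. ennreal (fail_prob X t / failure_rate X))"

definition retained_dist :: "('t, 'o) setting \<Rightarrow> 't measure" where
  "retained_dist X =
     density (measure_pmf (user_dist X)) (\<lambda>t. ennreal ((1 - fail_prob X t) / (1 - failure_rate X)))"

definition mean_gain_F :: "('t, 'o) setting \<Rightarrow> real" where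
  "mean_gain_F X = (\<integral>t. V X Candidate t - V X Current t \<partial>failure_dist X)"

definition L_gain :: "('t, 'o) setting \<Rightarrow> real" where
  "L_gain X = failure_rate X * mean_gain_F X"

definition D_R_minus :: "('t, 'o) setting \<Rightarrow> real" where
  "D_R_minus X = (\<integral>t. max 0 (V X Current t - V X Candidate t) \<partial>retained_dist X)"

section \<open>The improving two-task instance\<close>

datatype task = T_F | T_R

text \<open>The outputs 0 and 1 are encoded as \<open>False\<close> and \<open>True\<close>.\<close>

definition two_task :: "real \<Rightarrow> real \<Rightarrow> (task, bool) setting" where
  "two_task Z u =
     \<lparr> user_dist = map_pmf (\<lambda>b. if b then T_F else T_R) (bernoulli_pmf Z),
       reward = (\<lambda>t out. of_bool out),
       detect = (\<lambda>t out. t = T_F),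
       agent = (\<lambda>a t. case t of
                  T_F \<Rightarrow> bernoulli_pmf (case a of Current \<Rightarrow> 1 - u / Z | Candidate \<Rightarrow> 1 - u / (2 * Z))
                | T_R \<Rightarrow> return_pmf True) \<rparr>"

lemma two_task_instance:
  assumes "0 < Z" "Z < 1" "0 < u" "u \<le> Z / 2"
  shows "failure_rate (two_task Z u) = Z"
    and "remaining_gap (two_task Z u) = u"
    and "L_gain (two_task Z u) = u / 2"
    and "D_R_minus (two_task Z u) = 0"
proof -
  have p: "0 \<le> 1 - u / Z" "1 - u / Z \<le> 1" "0 \<le> 1 - u / (2 * Z)" "1 - u / (2 * Z) \<le> 1"
    using assms by (auto simp: field_simps)
  have E: "measure_pmf.expectation (map_pmf (\<lambda>b. if b then T_F else T_R) (bernoulli_pmf Z)) f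
      = Z * f T_F + (1 - Z) * f T_R" for f :: "task \<Rightarrow> real"
    using assms by simp
  have V: "V (two_task Z u) a t = (case t of T_F \<Rightarrow> (case a of Current \<Rightarrow> 1 - u / Z | Candidate \<Rightarrow> 1 - u / (2 * Z)) | T_R \<Rightarrow> 1)" for a t
    using p by (auto simp: V_def two_task_def split: task.splits side.splits)
  have F: "fail_prob (two_task Z u) t = of_bool (t = T_F)" for t
    by (auto simp: fail_prob_def two_task_def)
  have I: "(\<integral>t. f t \<partial>measure_pmf (user_dist (two_task Z u)))
      = Z * f T_F + (1 - Z) * f T_R" for f :: "task \<Rightarrow> real"
    using E[of f] by (simp add: two_task_def)
  show rate: "failure_rate (two_task Z u) = Z"
    by (simp add: failure_rate_def I F)
  show "remaining_gap (two_task Z u) = u"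
    using assms by (simp add: remaining_gap_def J_user_def I V field_simps)
  have "mean_gain_F (two_task Z u) =
      (\<integral>t. fail_prob (two_task Z u) t / Z * (V (two_task Z u) Candidate t - V (two_task Z u) Current t)
         \<partial>measure_pmf (user_dist (two_task Z u)))"
    unfolding mean_gain_F_def failure_dist_def rate
    using assms by (subst integral_real_density) (auto simp: F)
  then show "L_gain (two_task Z u) = u / 2"
    using assms by (simp add: L_gain_def rate I F V field_simps)
  have "max 0 (V (two_task Z u) Current t - V (two_task Z u) Candidate t) = 0" for t
    using assms by (auto simp: V field_simps split: task.splits)
  then show "D_R_minus (two_task Z u) = 0"
    by (simp add: D_R_minus_def)
qed

section \<open>Total variation and the mixing coefficient of the task stream\<close>

definition tv_dist :: "'x measure \<Rightarrow> 'x measure \<Rightarrow> real" where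
  "tv_dist M N = (SUP A\<in>sets M. \<bar>measure M A - measure N A\<bar>)"

abbreviation seqs :: "nat set \<Rightarrow> (nat \<Rightarrow> 't) measure" where
  "seqs I \<equiv> PiM I (\<lambda>_. count_space UNIV)"

text \<open>A stationary sequence of tasks (given by its law \<open>S\<close>) whose one-time marginal is \<open>D\<close>.\<close>

definition user_stream :: "'t pmf \<Rightarrow> (nat \<Rightarrow> 't) measure \<Rightarrow> bool" where
  "user_stream D S \<longleftrightarrow>
     prob_space S \<and> sets S = sets (seqs UNIV) \<and>
     distr S (seqs UNIV) (\<lambda>x i. x (Suc i)) = S \<and>
     distr S (count_space UNIV) (\<lambda>x. x 0) = measure_pmf D"

definition past :: "nat \<Rightarrow> (nat \<Rightarrow> 't) \<Rightarrow> nat \<Rightarrow> 't" where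
  "past s x = restrict x {..s}"

definition future :: "nat \<Rightarrow> (nat \<Rightarrow> 't) \<Rightarrow> nat \<Rightarrow> 't" where
  "future s x = (\<lambda>i. x (s + i))"

text \<open>
  The supremum over \<open>s\<close> of the total variation distance between the joint law of the past
  up to time \<open>s\<close> and the future from time \<open>s + l\<close>, and the product of their laws.
\<close>

definition beta_mixing :: "(nat \<Rightarrow> 't) measure \<Rightarrow> nat \<Rightarrow> real" where
  "beta_mixing S l =
     (SUP s. tv_dist
        (distr S (seqs {..s} \<Otimes>\<^sub>M seqs UNIV) (\<lambda>x. (past s x, future (s + l) x)))
        (distr S (seqs {..s}) (past s) \<Otimes>\<^sub>M distr S (seqs UNIV) (future (s + l))))"

text \<open>Independent tasks form a stream with vanishing mixing coefficients.\<close>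

lemma iid_stream:
  fixes D :: "'t pmf"
  defines "S \<equiv> PiM UNIV (\<lambda>_::nat. measure_pmf D)"
  shows "user_stream D S" and "0 < l \<Longrightarrow> beta_mixing S l = 0" and "beta_mixing S \<longlonglongrightarrow> 0"
proof -
  interpret P: product_prob_space "\<lambda>_::nat. measure_pmf D" UNIV
    by unfold_locales
  have sS: "sets S = sets (seqs UNIV)" unfolding S_def by (intro sets_PiM_cong) auto
  have iS: "prob_space S" unfolding S_def by unfold_locales
  interpret S: prob_space S by fact
  have comp: "distr S (count_space UNIV) (\<lambda>x. x i) = measure_pmf D" for i
    using P.PiM_component[of i] unfolding S_def
    by (metis UNIV_I distr_cong sets_measure_pmf_count_space)
  have ind: "S.indep_vars (\<lambda>_. count_space UNIV) (\<lambda>i x. x i) UNIV"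
    apply (subst S.indep_vars_iff_distr_eq_PiM)
    subgoal by simp
    subgoal unfolding S_def by measurable
    subgoal
      unfolding comp
      using sS by (metis (no_types, lifting) S_def distr_id2 restrict_UNIV distr_cong)
    done
  have shift: "distr S (seqs UNIV) (\<lambda>x i. x (Suc i)) = S"
  proof -
    have "distr (PiM UNIV (\<lambda>_::nat. measure_pmf D)) (PiM UNIV (\<lambda>_::nat. measure_pmf D)) (\<lambda>\<omega>. \<lambda>n\<in>UNIV. \<omega> (Suc n))
        = PiM UNIV (\<lambda>_::nat. measure_pmf D)"
      by (rule distr_PiM_reindex) (auto simp: prob_space_measure_pmf)
    moreover have "distr S (seqs UNIV) (\<lambda>x i. x (Suc i)) = distr S S (\<lambda>x i. x (Suc i))"
      by (intro distr_cong refl) (simp_all add: sS)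
    ultimately show ?thesis unfolding S_def by (simp add: restrict_UNIV)
  qed
  show "user_stream D S"
    unfolding user_stream_def using iS sS shift comp[of 0] by blast
  show zero: "beta_mixing S l = 0" if "0 < l" for l
  proof -
    have eq: "distr S (seqs {..s} \<Otimes>\<^sub>M seqs UNIV) (\<lambda>x. (past s x, future (s + l) x)) =
        distr S (seqs {..s}) (past s) \<Otimes>\<^sub>M distr S (seqs UNIV) (future (s + l))" for s
    proof -
      have 1: "S.indep_var (seqs {..s}) (\<lambda>\<omega>. restrict (\<lambda>i. \<omega> i) {..s}) (seqs {s+l..}) (\<lambda>\<omega>. restrict (\<lambda>i. \<omega> i) {s+l..})"
        using that by (intro S.indep_var_restrict[OF ind]) auto
      have m2: "(\<lambda>y i. y (s + l + i)) \<in> measurable (seqs {s+l..}) (seqs UNIV :: (nat \<Rightarrow> 't) measure)"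
        by (rule measurable_PiM_single') (auto intro!: measurable_component_singleton simp: space_PiM)
      have 2: "S.indep_var (seqs {..s}) ((\<lambda>y. y) \<circ> (\<lambda>\<omega>. restrict (\<lambda>i. \<omega> i) {..s})) (seqs UNIV)
          ((\<lambda>y i. y (s + l + i)) \<circ> (\<lambda>\<omega>. restrict (\<lambda>i. \<omega> i) {s+l..}))"
        by (rule S.indep_var_compose[OF 1 _ m2]) simp
      have p: "(\<lambda>y. y) \<circ> (\<lambda>\<omega>. restrict (\<lambda>i. \<omega> i) {..s}) = past s"
        "(\<lambda>y i. y (s + l + i)) \<circ> (\<lambda>\<omega>. restrict (\<lambda>i. \<omega> i) {s+l..}) = future (s + l)"
        by (auto simp: past_def future_def fun_eq_iff)
      show ?thesis
        using 2 unfolding p S.indep_var_distribution_eq by simp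
    qed
    show ?thesis
      unfolding beta_mixing_def eq tv_dist_def
      by (simp add: sets.top[THEN ex_in_conv[THEN iffD1, OF exI]])
  qed
  show "beta_mixing S \<longlonglongrightarrow> 0"
    by (intro tendsto_eventually eventually_sequentiallyI[of 1] zero) simp
qed

section \<open>Risk allocation, sample sizes and evaluation data\<close>

text \<open>\<open>risk_V\<close> is the total rollout risk \<open>2 (n\<^sub>F + n\<^sub>R) \<beta>\<^sub>V\<^sup>(\<^sup>1\<^sup>)\<close>, not the risk per reward estimate.\<close>

record allocation =
  risk_Z :: real
  risk_R :: real
  risk_F :: real
  risk_V :: real

definition valid_allocation :: "allocation \<Rightarrow> bool" where
  "valid_allocation r \<longleftrightarrow>
     risk_Z r \<in> {0<..<1} \<and> risk_R r \<in> {0<..<1} \<and> risk_F r \<in> {0<..<1} \<and> risk_V r \<in> {0<..<1}"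

record sizes =
  roll_n :: nat
  fail_n :: nat
  rec_n :: nat

text \<open>
  \<open>stored\<close> are the stored records (task, failure label); an unavailable sample is one of the
  wrong length.  \<open>screened\<close> are the tasks looked at by the failure-collection phase, with the
  output of \<open>A\<^sub>k\<close> on each of them.  \<open>rolls i a s\<close> is the output of the \<open>s\<close>-th rollout
  of agent \<open>a\<close> on the \<open>i\<close>-th evaluation task (see \<open>eval_tasks\<close>).
\<close>

record ('t, 'o) eval_data =
  stored :: "('t \<times> bool) list"
  screened :: "('t \<times> 'o) list"
  rolls :: "nat \<times> side \<times> nat \<Rightarrow> 'o"

definition failure_batch :: "('t, 'o) setting \<Rightarrow> nat \<Rightarrow> ('t \<times> 'o) list \<Rightarrow> 't list option" where
  "failure_batch X n sc =
     (let fs = map fst (filter (\<lambda>(t, out). detect X t out) sc)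
      in if n \<le> length fs then Some (take n fs) else None)"

definition eval_tasks ::
  "('t, 'o) setting \<Rightarrow> nat \<Rightarrow> ('t \<times> bool) list \<Rightarrow> ('t \<times> 'o) list \<Rightarrow> 't list" where
  "eval_tasks X n st sc =
     map fst st @ (case failure_batch X n sc of None \<Rightarrow> [] | Some ts \<Rightarrow> ts)"

definition rollout_pmf ::
  "('t, 'o) setting \<Rightarrow> nat \<Rightarrow> 't list \<Rightarrow> (nat \<times> side \<times> nat \<Rightarrow> 'o) pmf" where
  "rollout_pmf X m ts =
     Pi_pmf ({..<length ts} \<times> UNIV \<times> {..<m}) undefined (\<lambda>(i, a, s). agent X a (ts ! i))"

definition record_pmf :: "('t, 'o) setting \<Rightarrow> ('t \<times> bool) pmf" where
  "record_pmf X =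
     bind_pmf (user_dist X) (\<lambda>t. map_pmf (Pair t) (bernoulli_pmf (fail_prob X t)))"

section \<open>Evaluation designs\<close>

text \<open>
  \<open>law\<close> is the joint law of the generation information (of type \<open>'g\<close>) and the evaluation data;
  \<open>spacing\<close> is \<open>\<ell>\<close> and \<open>radius_F\<close> is \<open>\<epsilon>\<^sub>F\<close>.
\<close>

record ('g, 't, 'o) design =
  spacing :: nat
  horizon :: nat
  radius_F :: real
  law :: "('g \<times> ('t, 'o) eval_data) measure"

definition batch_error :: "('t, 'o) setting \<Rightarrow> sizes \<Rightarrow> 't list \<Rightarrow> real" where
  "batch_error X n ts =
     \<bar>(\<Sum>i<fail_n n. V X Candidate (ts ! i) - V X Current (ts ! i)) / real (fail_n n)
      - mean_gain_F X\<bar>"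

text \<open>
  The stored sample.  The two agents are fixed by the setting, so the pre-evaluation information
  varies only through the generation information, and the reference law is a product.
\<close>

definition stored_sample_ok ::
  "('t, 'o) setting \<Rightarrow> (nat \<Rightarrow> 't) measure \<Rightarrow> allocation \<Rightarrow> sizes \<Rightarrow> 'g measure
    \<Rightarrow> ('g, 't, 'o) design \<Rightarrow> bool" where
  "stored_sample_ok X S r n G E \<longleftrightarrow>
     0 < spacing E \<and>
     2 * real (rec_n n) * beta_mixing S (spacing E) < min (risk_Z r) (risk_R r) \<and>
     tv_dist (distr (law E) (G \<Otimes>\<^sub>M count_space UNIV) (\<lambda>(g, d). (g, stored d)))
             (G \<Otimes>\<^sub>M measure_pmf (replicate_pmf (rec_n n) (record_pmf X)))
       \<le> 2 * real (rec_n n) * beta_mixing S (spacing E)"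

text \<open>
  The failure-collection phase runs \<open>A\<^sub>k\<close> on \<open>horizon\<close> many tasks and returns the first
  failure-marked ones, or nothing if there are too few.  The sampling law of the tasks is
  constrained only through the deviation probability of the returned batch.
\<close>

definition failure_phase_ok ::
  "('t, 'o) setting \<Rightarrow> allocation \<Rightarrow> sizes \<Rightarrow> 'g measure \<Rightarrow> ('g, 't, 'o) design \<Rightarrow> bool" where
  "failure_phase_ok X r n G E \<longleftrightarrow>
     0 \<le> radius_F E \<and>
     (AE (g, d) in law E. length (screened d) = horizon E) \<and>
     (\<forall>B\<in>sets G. \<forall>st sc.
        measure (law E) {(g, d). g \<in> B \<and> stored d = st \<and> screened d = sc}
        = measure (law E) {(g, d). g \<in> B \<and> stored d = st \<and> map fst (screened d) = map fst sc}
          * prod_list (map (\<lambda>(t, out). pmf (agent X Current t) out) sc)) \<and>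
     measure (law E)
       {(g, d) \<in> space (law E). \<exists>ts. failure_batch X (fail_n n) (screened d) = Some ts \<and>
          batch_error X n ts > radius_F E}
       \<le> risk_F r"

text \<open>Conditionally on everything else, the rollouts are independent draws from the agents.\<close>

definition rollouts_ok ::
  "('t, 'o) setting \<Rightarrow> sizes \<Rightarrow> 'g measure \<Rightarrow> ('g, 't, 'o) design \<Rightarrow> bool" where
  "rollouts_ok X n G E \<longleftrightarrow>
     (\<forall>B\<in>sets G. \<forall>st sc \<rho>.
        measure (law E) {(g, d). g \<in> B \<and> stored d = st \<and> screened d = sc \<and> rolls d = \<rho>}
        = measure (law E) {(g, d). g \<in> B \<and> stored d = st \<and> screened d = sc}
          * pmf (rollout_pmf X (roll_n n) (eval_tasks X (fail_n n) st sc)) \<rho>)"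

definition evaluation_design ::
  "('t, 'o) setting \<Rightarrow> (nat \<Rightarrow> 't) measure \<Rightarrow> allocation \<Rightarrow> sizes \<Rightarrow> 'g measure
    \<Rightarrow> ('g, 't, 'o) design \<Rightarrow> bool" where
  "evaluation_design X S r n G E \<longleftrightarrow>
     prob_space (law E) \<and> sets (law E) = sets (G \<Otimes>\<^sub>M count_space UNIV) \<and>
     distr (law E) G fst = G \<and>
     stored_sample_ok X S r n G E \<and> failure_phase_ok X r n G E \<and> rollouts_ok X n G E"

section \<open>Estimates and radii\<close>

definition retained_idx :: "sizes \<Rightarrow> ('t, 'o) eval_data \<Rightarrow> nat set" where
  "retained_idx n d = {j. j < rec_n n \<and> \<not> snd (stored d ! j)}"

definition ready :: "('t, 'o) setting \<Rightarrow> sizes \<Rightarrow> ('t, 'o) eval_data \<Rightarrow> bool" where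
  "ready X n d \<longleftrightarrow>
     length (stored d) = rec_n n \<and> retained_idx n d \<noteq> {} \<and>
     failure_batch X (fail_n n) (screened d) \<noteq> None"

definition task_list :: "('t, 'o) setting \<Rightarrow> sizes \<Rightarrow> ('t, 'o) eval_data \<Rightarrow> 't list" where
  "task_list X n d = eval_tasks X (fail_n n) (stored d) (screened d)"

definition V_hat :: "('t, 'o) setting \<Rightarrow> sizes \<Rightarrow> ('t, 'o) eval_data \<Rightarrow> side \<Rightarrow> nat \<Rightarrow> real" where
  "V_hat X n d a i =
     (\<Sum>s<roll_n n. reward X (task_list X n d ! i) (rolls d (i, a, s))) / real (roll_n n)"

definition Z_hat :: "sizes \<Rightarrow> ('t, 'o) eval_data \<Rightarrow> real" where
  "Z_hat n d = (\<Sum>j<rec_n n. of_bool (snd (stored d ! j))) / real (rec_n n)"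

text \<open>When the data are ready, the \<open>i\<close>-th failure task sits at position \<open>rec_n n + i\<close>.\<close>

definition L_hat :: "('t, 'o) setting \<Rightarrow> sizes \<Rightarrow> ('t, 'o) eval_data \<Rightarrow> real" where
  "L_hat X n d =
     Z_hat n d *
     ((\<Sum>i<fail_n n. V_hat X n d Candidate (rec_n n + i) - V_hat X n d Current (rec_n n + i))
      / real (fail_n n))"

definition D_hat :: "('t, 'o) setting \<Rightarrow> sizes \<Rightarrow> ('t, 'o) eval_data \<Rightarrow> real" where
  "D_hat X n d =
     (\<Sum>j\<in>retained_idx n d. max 0 (V_hat X n d Current j - V_hat X n d Candidate j))
     / real (card (retained_idx n d))"

definition rollout_risk :: "allocation \<Rightarrow> sizes \<Rightarrow> real" where
  "rollout_risk r n = risk_V r / (2 * (real (fail_n n) + real (rec_n n)))"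

definition eps_V :: "allocation \<Rightarrow> sizes \<Rightarrow> real" where
  "eps_V r n = sqrt (ln (2 / rollout_risk r n) / (2 * real (roll_n n)))"

definition mixing_loss :: "(nat \<Rightarrow> 't) measure \<Rightarrow> sizes \<Rightarrow> ('g, 't, 'o) design \<Rightarrow> real" where
  "mixing_loss S n E = 2 * real (rec_n n) * beta_mixing S (spacing E)"

definition eps_Z ::
  "(nat \<Rightarrow> 't) measure \<Rightarrow> allocation \<Rightarrow> sizes \<Rightarrow> ('g, 't, 'o) design \<Rightarrow> real" where
  "eps_Z S r n E = sqrt (ln (2 / (risk_Z r - mixing_loss S n E)) / (2 * real (rec_n n)))"

definition eps_R ::
  "(nat \<Rightarrow> 't) measure \<Rightarrow> allocation \<Rightarrow> sizes \<Rightarrow> ('g, 't, 'o) design \<Rightarrow> real" where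
  "eps_R S r n E = sqrt (ln (2 / (risk_R r - mixing_loss S n E)) / (2 * real (rec_n n)))"

definition eps_L ::
  "(nat \<Rightarrow> 't) measure \<Rightarrow> allocation \<Rightarrow> sizes \<Rightarrow> ('g, 't, 'o) design \<Rightarrow> ('t, 'o) eval_data \<Rightarrow> real"
  where
  "eps_L S r n E d = eps_Z S r n E + (Z_hat n d + eps_Z S r n E) * (2 * eps_V r n + radius_F E)"

definition eps_D ::
  "(nat \<Rightarrow> 't) measure \<Rightarrow> allocation \<Rightarrow> sizes \<Rightarrow> ('g, 't, 'o) design \<Rightarrow> ('t, 'o) eval_data \<Rightarrow> real"
  where
  "eps_D S r n E d = (2 * eps_V r n + eps_R S r n E + eps_Z S r n E) / (1 - Z_hat n d)"

section \<open>Joint error bounds and the validation rule\<close>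

definition joint_error_bounds ::
  "('t, 'o) setting \<Rightarrow> (nat \<Rightarrow> 't) measure \<Rightarrow> allocation \<Rightarrow> sizes \<Rightarrow> ('g, 't, 'o) design
    \<Rightarrow> ('t, 'o) eval_data \<Rightarrow> bool" where
  "joint_error_bounds X S r n E d \<longleftrightarrow>
     \<bar>Z_hat n d - failure_rate X\<bar> \<le> eps_Z S r n E \<and>
     (\<forall>a. \<forall>i<length (task_list X n d).
        \<bar>V_hat X n d a i - V X a (task_list X n d ! i)\<bar> \<le> eps_V r n) \<and>
     (\<forall>ts. failure_batch X (fail_n n) (screened d) = Some ts \<longrightarrow> batch_error X n ts \<le> radius_F E) \<and>
     \<bar>(\<Sum>j<rec_n n. (1 - of_bool (snd (stored d ! j))) *
          max 0 (V X Current (fst (stored d ! j)) - V X Candidate (fst (stored d ! j))))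
        / real (rec_n n)
      - (1 - failure_rate X) * D_R_minus X\<bar> \<le> eps_R S r n E"

definition M_hat ::
  "('t, 'o) setting \<Rightarrow> (nat \<Rightarrow> 't) measure \<Rightarrow> allocation \<Rightarrow> sizes \<Rightarrow> ('g, 't, 'o) design
    \<Rightarrow> ('t, 'o) eval_data \<Rightarrow> real" where
  "M_hat X S r n E d =
     L_hat X n d - eps_L S r n E d
     - (1 - Z_hat n d + eps_Z S r n E) * (D_hat X n d + eps_D S r n E d)"

definition validates ::
  "real \<Rightarrow> ('t, 'o) setting \<Rightarrow> (nat \<Rightarrow> 't) measure \<Rightarrow> allocation \<Rightarrow> sizes \<Rightarrow> ('g, 't, 'o) design
    \<Rightarrow> ('t, 'o) eval_data \<Rightarrow> bool" where
  "validates \<delta> X S r n E d \<longleftrightarrow>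
     ready X n d \<and> D_hat X n d \<le> \<delta> \<and> M_hat X S r n E d > 0"

end

theory Submission
  imports Defs
begin

text \<open>
  On the two-task instance no retained task gets worse, and every failure-marked task is \<open>T_F\<close>, so
  \<open>\<epsilon>\<^sub>F = 0\<close> is a legitimate radius; under the joint error bounds the measured margin is at least \<open>u / 4\<close> minus a fixed multiple of the radii \<open>\<epsilon>\<^sub>V\<close>, \<open>\<epsilon>\<^sub>Z\<close>, \<open>\<epsilon>\<^sub>R\<close>.  It therefore suffices
  that these radii are at most a small multiple of \<open>u\<close>.  The spacing is chosen so large that at most
  half of the risks is lost to mixing; then \<open>n\<^sub>R\<close> of order \<open>u\<^sup>-\<^sup>2\<close> is enough, and the union bound over
  the reward estimates costs one factor \<open>ln (1 / u)\<close> in \<open>m\<close>.  As the risks may add up to more than 1,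
  the joint error bounds are shown to be possible by exhibiting one data point of positive
  probability, whose frequencies are rounded down to multiples of \<open>1 / n\<^sub>R\<close> and \<open>1 / m\<close>.
\<close>

section \<open>Nonnegativity of the mixing coefficient\<close>

text \<open>Suprema of reals can be estimated only for bounded families. Differences of two
  probabilities are at most 1 in absolute value, and the empty event contributes 0. The sign makes a
  total variation distance of 0 admissible and keeps the mixing loss from enlarging the
  risks.\<close>

lemma beta_mixing_nonneg:
  assumes "user_stream D S"
  shows "0 \<le> beta_mixing S l"
proof -
  interpret S: prob_space S using assms by (simp add: user_stream_def)
  have [measurable_cong]: "sets S = sets (seqs UNIV)"
    using assms by (simp add: user_stream_def)
  have past [measurable]: "past s \<in> measurable S (seqs {..s})" for s
    unfolding past_def by measurable
  have future [measurable]: "future s \<in> measurable S (seqs UNIV)" for s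
    unfolding future_def by (rule measurable_PiM_single') auto
  define P where "P s = distr S (seqs {..s} \<Otimes>\<^sub>M seqs UNIV) (\<lambda>x. (past s x, future (s + l) x))" for s
  define Q where "Q s = distr S (seqs {..s}) (past s) \<Otimes>\<^sub>M distr S (seqs UNIV) (future (s + l))" for s
  have P: "prob_space (P s)" for s
    unfolding P_def by (rule S.prob_space_distr) measurable
  have Q: "prob_space (Q s)" for s
    unfolding Q_def by (intro prob_space_pair S.prob_space_distr) measurable
  have le: "\<bar>measure (P s) A - measure (Q s) A\<bar> \<le> 1" for s A
    using prob_space.prob_le_1[OF P, of s A] prob_space.prob_le_1[OF Q, of s A]
      measure_nonneg[of "P s" A] measure_nonneg[of "Q s" A] by linarith
  have "0 \<le> tv_dist (P s) (Q s)" for s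
    unfolding tv_dist_def
    by (rule cSUP_upper2[of _ _ "{}"]) (auto intro!: bdd_aboveI[of _ 1] simp: le)
  moreover have "tv_dist (P s) (Q s) \<le> 1" for s
    unfolding tv_dist_def using sets.empty_sets by (intro cSUP_least) (auto simp: le)
  ultimately have "0 \<le> (SUP s. tv_dist (P s) (Q s))"
    by (intro cSUP_upper2[of _ _ 0]) (auto intro!: bdd_aboveI[of _ 1])
  then show ?thesis
    by (simp add: beta_mixing_def P_def Q_def)
qed

section \<open>Point masses of lists and of dependent pairs\<close>

lemma pmf_replicate_pmf:
  "pmf (replicate_pmf n p) xs = (if length xs = n then prod_list (map (pmf p) xs) else 0)"
proof (induction n arbitrary: xs)
  case 0
  then show ?case by (auto simp: indicator_def)
next
  case (Suc n)
  have eq: "replicate_pmf (Suc n) p = map_pmf (\<lambda>(x, xs). x # xs) (pair_pmf p (replicate_pmf n p))"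
    by (simp add: pair_pmf_def map_pmf_def bind_assoc_pmf bind_return_pmf)
  show ?case
  proof (cases xs)
    case Nil
    have "[] \<notin> set_pmf (replicate_pmf (Suc n) p)" unfolding set_replicate_pmf by simp
    then show ?thesis using Nil by (simp add: pmf_eq_0_set_pmf)
  next
    case (Cons y ys)
    have "pmf (replicate_pmf (Suc n) p) xs = pmf (pair_pmf p (replicate_pmf n p)) (y, ys)"
      unfolding eq Cons
      by (rule trans[OF _ pmf_map_inj'[where f = "\<lambda>(x, xs). x # xs"]]) (auto simp: inj_on_def)
    then show ?thesis using Suc Cons by (simp add: pmf_pair)
  qed
qed

lemma pmf_bind_Pair:
  "pmf (bind_pmf p (\<lambda>x. map_pmf (Pair x) (q x))) (x, y) = pmf p x * pmf (q x) y"
proof -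
  have "pmf (map_pmf (Pair x') (q x')) (x, y) = indicator {x} x' * pmf (q x) y" for x'
  proof (cases "x' = x")
    case True
    then show ?thesis by (simp add: pmf_map_inj' inj_on_def)
  next
    case False
    then have "(x, y) \<notin> set_pmf (map_pmf (Pair x') (q x'))" by auto
    then show ?thesis using False by (simp add: pmf_eq_0_set_pmf)
  qed
  then show ?thesis by (simp add: pmf_bind measure_pmf_single)
qed

section \<open>A concrete law of the evaluation data and the design built on it\<close>

text \<open>Exactly \<open>fail_n n\<close> runs are made on \<open>t\<close>, so a batch is
  returned only if all of them are marked. On the two-task instance with \<open>t = T_F\<close> this
  always happens.\<close>

definition recorded_pmf ::
  "('t, 'o) setting \<Rightarrow> sizes \<Rightarrow> 't \<Rightarrow> (('t \<times> bool) list \<times> ('t \<times> 'o) list) pmf" where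
  "recorded_pmf X n t =
     pair_pmf (replicate_pmf (rec_n n) (record_pmf X))
       (map_pmf (map (Pair t)) (replicate_pmf (fail_n n) (agent X Current t)))"

text \<open>Two stages are used because the law of the rollouts depends on the task list fixed by
  the recorded part.\<close>

definition eval_pmf :: "('t, 'o) setting \<Rightarrow> sizes \<Rightarrow> 't \<Rightarrow> ('t, 'o) eval_data pmf" where
  "eval_pmf X n t =
     map_pmf (\<lambda>((st, sc), \<rho>). \<lparr> stored = st, screened = sc, rolls = \<rho> \<rparr>)
       (bind_pmf (recorded_pmf X n t) (\<lambda>x. map_pmf (Pair x)
          (rollout_pmf X (roll_n n) (eval_tasks X (fail_n n) (fst x) (snd x)))))"

lemma map_eval_pmf:
  "map_pmf (\<lambda>d. ((stored d, screened d), rolls d)) (eval_pmf X n t) =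
     bind_pmf (recorded_pmf X n t) (\<lambda>x. map_pmf (Pair x)
       (rollout_pmf X (roll_n n) (eval_tasks X (fail_n n) (fst x) (snd x))))"
  unfolding eval_pmf_def pmf.map_comp
  by (rule trans[OF pmf.map_cong pmf.map_id]) (auto simp: split: prod.splits)

lemma map_eval_pmf_recorded:
  "map_pmf (\<lambda>d. (stored d, screened d)) (eval_pmf X n t) = recorded_pmf X n t"
proof -
  have "map_pmf (\<lambda>d. (stored d, screened d)) (eval_pmf X n t) =
      map_pmf fst (map_pmf (\<lambda>d. ((stored d, screened d), rolls d)) (eval_pmf X n t))"
    by (simp add: pmf.map_comp o_def)
  then show ?thesis
    by (simp add: map_eval_pmf map_bind_pmf pmf.map_comp o_def bind_return_pmf')
qed

lemma map_eval_pmf_stored: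
  "map_pmf stored (eval_pmf X n t) = replicate_pmf (rec_n n) (record_pmf X)"
proof -
  have "map_pmf stored (eval_pmf X n t) =
      map_pmf fst (map_pmf (\<lambda>d. (stored d, screened d)) (eval_pmf X n t))"
    by (simp add: pmf.map_comp o_def)
  then show ?thesis
    by (simp add: map_eval_pmf_recorded recorded_pmf_def map_fst_pair_pmf)
qed

lemma screened_eval_pmf:
  assumes "d \<in> set_pmf (eval_pmf X n t)"
  shows "map fst (screened d) = replicate (fail_n n) t"
proof -
  have "(stored d, screened d) \<in> set_pmf (recorded_pmf X n t)"
    using assms unfolding map_eval_pmf_recorded[symmetric] by auto
  then show ?thesis
    by (auto simp: recorded_pmf_def set_replicate_pmf o_def map_replicate_const)
qed

lemma pmf_eval_pmf:
  "pmf (eval_pmf X n t) d =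
     pmf (replicate_pmf (rec_n n) (record_pmf X)) (stored d) *
     pmf (map_pmf (map (Pair t)) (replicate_pmf (fail_n n) (agent X Current t))) (screened d) *
     pmf (rollout_pmf X (roll_n n) (eval_tasks X (fail_n n) (stored d) (screened d))) (rolls d)"
proof -
  have "inj (\<lambda>d::('a, 'b) eval_data. ((stored d, screened d), rolls d))"
    by (rule injI) simp
  then have "pmf (eval_pmf X n t) d =
      pmf (map_pmf (\<lambda>d. ((stored d, screened d), rolls d)) (eval_pmf X n t))
        ((stored d, screened d), rolls d)"
    by (rule pmf_map_inj'[symmetric])
  then show ?thesis
    by (simp add: map_eval_pmf pmf_bind_Pair recorded_pmf_def pmf_pair)
qed

lemma prob_recorded:
  "measure_pmf.prob (eval_pmf X n t) {d. stored d = st \<and> screened d = sc} =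
     pmf (replicate_pmf (rec_n n) (record_pmf X)) st *
     pmf (map_pmf (map (Pair t)) (replicate_pmf (fail_n n) (agent X Current t))) sc"
proof -
  have "measure_pmf.prob (eval_pmf X n t) {d. stored d = st \<and> screened d = sc} =
      pmf (map_pmf (\<lambda>d. (stored d, screened d)) (eval_pmf X n t)) (st, sc)"
    by (auto simp: pmf_map intro!: arg_cong[where f = "measure_pmf.prob _"])
  then show ?thesis
    by (simp add: map_eval_pmf_recorded recorded_pmf_def pmf_pair)
qed

text \<open>The screened tasks are almost surely copies of \<open>t\<close>. If \<open>sc\<close>
  has these tasks, fixing them is no restriction and the independent outputs contribute the product;
  otherwise both sides vanish.\<close>

lemma prob_screened_outputs:
  "measure_pmf.prob (eval_pmf X n t) {d. stored d = st \<and> screened d = sc} =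
     measure_pmf.prob (eval_pmf X n t) {d. stored d = st \<and> map fst (screened d) = map fst sc} *
     prod_list (map (\<lambda>(t, out). pmf (agent X Current t) out) sc)"
proof (cases "map fst sc = replicate (fail_n n) t")
  case True
  then have len: "length sc = fail_n n"
    by (metis length_map length_replicate)
  have t: "x = t" if "(x, y) \<in> set sc" for x y
    using that True by (metis fst_conv in_set_replicate list.set_map rev_image_eqI)
  have sc: "sc = map (Pair t) (map snd sc)"
    unfolding map_map by (rule map_idI[symmetric]) (use t in auto)
  have "measure_pmf.prob (eval_pmf X n t) {d. stored d = st \<and> map fst (screened d) = map fst sc} =
      measure_pmf.prob (eval_pmf X n t) (stored -` {st})"
    using screened_eval_pmf[of _ X n t] True
    by (intro measure_pmf.finite_measure_eq_AE) (auto simp: AE_measure_pmf_iff)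
  also have "\<dots> = pmf (replicate_pmf (rec_n n) (record_pmf X)) st"
    by (simp add: map_eval_pmf_stored[of X n t, symmetric] pmf_map)
  moreover have "pmf (map_pmf (map (Pair t)) (replicate_pmf (fail_n n) (agent X Current t))) sc =
      prod_list (map (\<lambda>(t, out). pmf (agent X Current t) out) sc)"
  proof -
    have "pmf (map_pmf (map (Pair t)) (replicate_pmf (fail_n n) (agent X Current t))) sc =
        pmf (replicate_pmf (fail_n n) (agent X Current t)) (map snd sc)"
      by (subst sc, rule pmf_map_inj') (auto intro: inj_onI)
    also have "\<dots> = prod_list (map (\<lambda>(t, out). pmf (agent X Current t) out) sc)"
      using len t by (auto simp: pmf_replicate_pmf intro!: arg_cong[where f = prod_list])
    finally show ?thesis .
  qed
  ultimately show ?thesis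
    by (simp add: prob_recorded)
next
  case False
  then have "measure_pmf.prob (eval_pmf X n t) {d. stored d = st \<and> map fst (screened d) = map fst sc} = 0"
    and "measure_pmf.prob (eval_pmf X n t) {d. stored d = st \<and> screened d = sc} = 0"
    using screened_eval_pmf[of _ X n t] by (auto simp: measure_pmf_zero_iff)
  then show ?thesis by simp
qed

text \<open>The three fields determine the data, so the event on the left is a single point.\<close>

lemma prob_rolls:
  "measure_pmf.prob (eval_pmf X n t) {d. stored d = st \<and> screened d = sc \<and> rolls d = \<rho>} =
     measure_pmf.prob (eval_pmf X n t) {d. stored d = st \<and> screened d = sc} *
     pmf (rollout_pmf X (roll_n n) (eval_tasks X (fail_n n) st sc)) \<rho>"
proof -
  have "{d. stored d = st \<and> screened d = sc \<and> rolls d = \<rho>} =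
      {\<lparr> stored = st, screened = sc, rolls = \<rho> \<rparr>}"
    by auto
  then show ?thesis
    by (simp add: measure_pmf_single pmf_eval_pmf prob_recorded)
qed

text \<open>
  Collection runs \<open>A\<^sub>k\<close> on copies of one task only: the design constrains the sampling law of the
  screened tasks solely through the deviation probability of the batch.
\<close>

definition fixed_task_design ::
  "('t, 'o) setting \<Rightarrow> sizes \<Rightarrow> 't \<Rightarrow> nat \<Rightarrow> real \<Rightarrow> 'g measure \<Rightarrow> ('g, 't, 'o) design" where
  "fixed_task_design X n t l rad G =
     \<lparr> spacing = l, horizon = fail_n n, radius_F = rad,
       law = G \<Otimes>\<^sub>M measure_pmf (eval_pmf X n t) \<rparr>"

lemma fixed_task_design_simps [simp]:
  "spacing (fixed_task_design X n t l rad G) = l"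
  "horizon (fixed_task_design X n t l rad G) = fail_n n"
  "radius_F (fixed_task_design X n t l rad G) = rad"
  "law (fixed_task_design X n t l rad G) = G \<Otimes>\<^sub>M measure_pmf (eval_pmf X n t)"
  by (simp_all add: fixed_task_design_def)

lemma measure_pair_pmf_Times:
  assumes "B \<in> sets G"
  shows "measure (G \<Otimes>\<^sub>M measure_pmf p) (B \<times> A) = measure G B * measure_pmf.prob p A"
  using assms by (simp add: measure_def measure_pmf.emeasure_pair_measure_Times enn2real_mult)

text \<open>Generation information and data are independent, so the stored sample follows the
  reference law exactly. The hypothesis on batches makes the deviation event empty, whence any
  nonnegative \<open>risk_F r\<close> is respected.\<close>

lemma evaluation_design_fixed_task:
  assumes G: "prob_space G" and l: "0 < l" and beta: "0 \<le> beta_mixing S l"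
    and loss: "2 * real (rec_n n) * beta_mixing S l < min (risk_Z r) (risk_R r)"
    and rad: "0 \<le> rad" and risk: "0 \<le> risk_F r"
    and batch: "\<And>sc ts. failure_batch X (fail_n n) sc = Some ts \<Longrightarrow> batch_error X n ts \<le> rad"
  shows "evaluation_design X S r n G (fixed_task_design X n t l rad G)"
proof -
  interpret G: prob_space G by fact
  interpret pair_prob_space G "measure_pmf (eval_pmf X n t)" by unfold_locales
  let ?P = "eval_pmf X n t" and ?E = "fixed_task_design X n t l rad G"
  let ?L = "G \<Otimes>\<^sub>M measure_pmf ?P"
  have "distr ?L (G \<Otimes>\<^sub>M count_space UNIV) (\<lambda>(g, d). (g, stored d)) =
      distr G G (\<lambda>g. g) \<Otimes>\<^sub>M distr (measure_pmf ?P) (count_space UNIV) stored"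
    by (rule pair_measure_distr[symmetric])
      (auto intro!: prob_space_imp_sigma_finite measure_pmf.prob_space_distr)
  also have "\<dots> = G \<Otimes>\<^sub>M measure_pmf (replicate_pmf (rec_n n) (record_pmf X))"
    by (simp add: map_eval_pmf_stored[of X n t, symmetric] map_pmf_rep_eq)
  \<comment> \<open>The two laws agree, so the distance is the supremum of the constant 0 over a
    nonempty family of events.\<close>
  finally have stored: "stored_sample_ok X S r n G ?E"
    using l beta loss by (simp add: stored_sample_ok_def tv_dist_def sets.top[THEN ex_in_conv[THEN iffD1, OF exI]])
  have "{(g, d). g \<in> space G \<and> length (screened d) = fail_n n} = space G \<times> {d. length (screened d) = fail_n n}"
    by auto
  moreover have "measure_pmf.prob ?P {d. length (screened d) = fail_n n} = 1"
    using screened_eval_pmf[of _ X n t]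
    by (intro measure_pmf.prob_eq_1[THEN iffD2])
      (auto simp: AE_measure_pmf_iff, metis length_map length_replicate)
  ultimately have "measure ?L {(g, d). g \<in> space G \<and> length (screened d) = fail_n n} = 1"
    using measure_pair_pmf_Times[OF sets.top[of G], of ?P "{d. length (screened d) = fail_n n}"]
    by (simp add: G.prob_space)
  then have AE: "AE (g, d) in ?L. length (screened d) = fail_n n"
    using AE_prob_1 by fastforce
  have empty: "{(g, d) \<in> space ?L. \<exists>ts. failure_batch X (fail_n n) (screened d) = Some ts \<and>
          batch_error X n ts > rad} = {}"
    using batch by fastforce
  have phase: "failure_phase_ok X r n G ?E"
    unfolding failure_phase_ok_def fixed_task_design_simps
    using rad risk AE unfolding empty
    by (simp add: measure_pair_pmf_Times prob_screened_outputs[of X n t])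
  have rolls: "rollouts_ok X n G ?E"
    by (simp add: rollouts_ok_def measure_pair_pmf_Times prob_rolls)
  have "distr ?L G fst = G"
    by (rule measure_pmf.distr_pair_fst)
  moreover have "sets ?L = sets (G \<Otimes>\<^sub>M count_space UNIV)"
    by (intro sets_pair_measure_cong) auto
  moreover have "prob_space ?L"
    by unfold_locales
  ultimately show ?thesis
    using stored phase rolls by (simp add: evaluation_design_def)
qed

section \<open>The two-task instance: values, failure batches and validation\<close>

lemma V_two_task:
  assumes "0 < Z" "0 < u" "u \<le> Z / 2"
  shows "V (two_task Z u) Current T_F = 1 - u / Z"
    and "V (two_task Z u) Candidate T_F = 1 - u / (2 * Z)"
    and "V (two_task Z u) a T_R = 1"
proof -
  have "0 \<le> 1 - u / Z" "1 - u / Z \<le> 1" "0 \<le> 1 - u / (2 * Z)" "1 - u / (2 * Z) \<le> 1"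
    using assms by (auto simp: field_simps)
  then show "V (two_task Z u) Current T_F = 1 - u / Z"
    and "V (two_task Z u) Candidate T_F = 1 - u / (2 * Z)"
    and "V (two_task Z u) a T_R = 1"
    by (auto simp: V_def two_task_def)
qed

lemma V_two_task_le:
  assumes "0 < Z" "0 < u" "u \<le> Z / 2"
  shows "V (two_task Z u) Current t \<le> V (two_task Z u) Candidate t"
  using assms by (cases t) (auto simp: V_two_task field_simps)

lemma failure_batch_SomeD:
  assumes "failure_batch X n sc = Some ts"
  shows "length ts = n" and "t \<in> set ts \<Longrightarrow> \<exists>out. detect X t out"
proof -
  let ?fs = "filter (\<lambda>(t, out). detect X t out) sc"
  have ts: "n \<le> length ?fs" "ts = take n (map fst ?fs)"
    using assms by (auto simp: failure_batch_def Let_def split: if_splits)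
  then show "length ts = n" by simp
  assume "t \<in> set ts"
  then have "t \<in> set (map fst ?fs)" unfolding ts by (rule in_set_takeD)
  then show "\<exists>out. detect X t out" by auto
qed

lemma failure_batch_two_task:
  assumes "failure_batch (two_task Z u) n sc = Some ts"
  shows "ts = replicate n T_F"
  using failure_batch_SomeD[OF assms]
  by (auto simp: two_task_def intro!: replicate_eqI)

text \<open>The failure distribution is concentrated on \<open>T_F\<close>, so the batch mean has no
  sampling error; its target is read off from \<open>L_gain\<close> being
  \<open>u / 2\<close>.\<close>

lemma batch_error_two_task:
  assumes "0 < Z" "Z < 1" "0 < u" "u \<le> Z / 2" "0 < fail_n n"
  shows "batch_error (two_task Z u) n (replicate (fail_n n) T_F) = 0"
proof -
  have "Z * mean_gain_F (two_task Z u) = u / 2"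
    using two_task_instance[OF assms(1-4)] by (simp add: L_gain_def)
  then have "mean_gain_F (two_task Z u) = u / (2 * Z)"
    using assms(1) by (simp add: field_simps)
  then show ?thesis
    using assms by (simp add: batch_error_def V_two_task field_simps)
qed

lemma task_list_ready:
  assumes "ready X n d"
  obtains ts where "failure_batch X (fail_n n) (screened d) = Some ts"
    and "task_list X n d = map fst (stored d) @ ts"
  using assms by (auto simp: ready_def task_list_def eval_tasks_def split: option.splits)

text \<open>The constant 100 leaves slack in the final margin. The factor \<open>1 - Z\<close> keeps
  the estimated retained rate \<open>1 - Z_hat n d\<close> positive and at least
  \<open>eps_Z\<close>, so that dividing by it in \<open>eps_D\<close> costs at most a factor
  2.\<close>

lemma validates_two_task:
  fixes E :: "('g, task, bool) design"
  assumes Z: "0 < Z" "Z < 1" and u: "0 < u" "u \<le> Z / 2" "u \<le> (1 - Z) * \<delta>" and "0 < \<delta>"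
    and n: "0 < fail_n n" "0 < rec_n n"
    and eV: "eps_V r n \<le> (1 - Z) / 100 * u"
    and eZ: "eps_Z S r n E \<le> (1 - Z) / 100 * u"
    and eR: "eps_R S r n E \<le> (1 - Z) / 100 * u"
    and rad: "radius_F E = 0"
    and ready: "ready (two_task Z u) n d"
    and joint: "joint_error_bounds (two_task Z u) S r n E d"
  shows "validates \<delta> (two_task Z u) S r n E d"
proof -
  let ?X = "two_task Z u"
  define v z e where "v = eps_V r n" and "z = eps_Z S r n E" and "e = eps_R S r n E"
  define h where "h = Z_hat n d"
  obtain ts where ts: "failure_batch ?X (fail_n n) (screened d) = Some ts"
    and tl: "task_list ?X n d = map fst (stored d) @ ts"
    using ready by (rule task_list_ready)
  have ts': "ts = replicate (fail_n n) T_F"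
    using failure_batch_two_task[OF ts] .
  have len: "length (stored d) = rec_n n" and ne: "retained_idx n d \<noteq> {}"
    using ready by (auto simp: ready_def)
  have V: "\<bar>V_hat ?X n d a i - V ?X a (task_list ?X n d ! i)\<bar> \<le> v"
    if "i < rec_n n + fail_n n" for a i
    using joint that len ts' by (auto simp: joint_error_bounds_def tl v_def)
  have h: "\<bar>h - Z\<bar> \<le> z"
    using joint Z u by (simp add: joint_error_bounds_def h_def z_def two_task_instance)
  have h1: "h \<le> 1"
  proof -
    have "(\<Sum>j<rec_n n. of_bool (snd (stored d ! j)) :: real) \<le> (\<Sum>j<rec_n n. 1)"
      by (rule sum_mono) simp
    then show ?thesis using n by (simp add: h_def Z_hat_def field_simps)
  qed
  have h0: "0 \<le> h" by (auto simp: h_def Z_hat_def intro!: divide_nonneg_nonneg sum_nonneg)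
  \<comment> \<open>The radii are not assumed nonnegative, and \<open>sqrt\<close> is negative at
    negative arguments; each sign follows from an absolute deviation lying below the radius.\<close>
  have v0: "0 \<le> v" using V[of 0 Current] n by linarith
  have z0: "0 \<le> z" using h by linarith
  have e0: "0 \<le> e" using joint by (auto simp: joint_error_bounds_def e_def intro: order_trans[OF abs_ge_zero])
  have u1: "(1 - Z) * u \<le> (1 - Z) / 2" "(1 - Z) * u \<le> u"
    using Z u mult_left_mono[of u "1/2" "1 - Z"] mult_right_mono[of "1 - Z" 1 u] by auto
  have small: "v \<le> u / 100" "z \<le> u / 100" "e \<le> u / 100" "z \<le> (1 - Z) / 200"
    using eV eZ eR u1 by (auto simp: v_def z_def e_def)
  \<comment> \<open>No true value decreases, so an observed decrease comes from two estimation
    errors.\<close>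
  have D: "D_hat ?X n d \<le> 2 * v"
  proof -
    have "max 0 (V_hat ?X n d Current j - V_hat ?X n d Candidate j) \<le> 2 * v"
      if "j \<in> retained_idx n d" for j
      using that V[of j Current] V[of j Candidate] V_two_task_le[OF Z(1) u(1,2), of "task_list ?X n d ! j"] v0
      by (auto simp: retained_idx_def)
    then have "(\<Sum>j\<in>retained_idx n d. max 0 (V_hat ?X n d Current j - V_hat ?X n d Candidate j))
        \<le> real (card (retained_idx n d)) * (2 * v)"
      by (rule sum_bounded_above)
    moreover have "0 < card (retained_idx n d)"
      using ne by (auto simp: card_gt_0_iff retained_idx_def)
    ultimately show ?thesis by (simp add: D_hat_def field_simps)
  qed
  have L: "h * (u / (2 * Z) - 2 * v) \<le> L_hat ?X n d"
  proof -
    have "u / (2 * Z) - 2 * v \<le>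
        V_hat ?X n d Candidate (rec_n n + i) - V_hat ?X n d Current (rec_n n + i)"
      if "i < fail_n n" for i
    proof -
      have "V ?X Candidate T_F - V ?X Current T_F = u / (2 * Z)"
        using Z u by (simp add: V_two_task field_simps)
      moreover have "task_list ?X n d ! (rec_n n + i) = T_F"
        using that len by (simp add: tl ts' nth_append)
      ultimately show ?thesis
        using V[of "rec_n n + i" Candidate] V[of "rec_n n + i" Current] that by simp
    qed
    then have "real (fail_n n) * (u / (2 * Z) - 2 * v) \<le>
        (\<Sum>i<fail_n n. V_hat ?X n d Candidate (rec_n n + i) - V_hat ?X n d Current (rec_n n + i))"
      using sum_bounded_below[of "{..<fail_n n}" "u / (2 * Z) - 2 * v"] by simp
    then have "u / (2 * Z) - 2 * v \<le>
        (\<Sum>i<fail_n n. V_hat ?X n d Candidate (rec_n n + i) - V_hat ?X n d Current (rec_n n + i))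
        / real (fail_n n)"
      using n by (simp add: pos_le_divide_eq mult.commute)
    then show ?thesis
      unfolding L_hat_def h_def[symmetric] using h0 by (rule mult_left_mono)
  qed
  have "u / 4 - 2 * v \<le> h * (u / (2 * Z) - 2 * v)"
  proof -
    \<comment> \<open>Here \<open>z\<close> is at most \<open>u / 100\<close>, hence well below
      \<open>Z / 2\<close>. Replacing \<open>h\<close> by \<open>Z / 2\<close> gives the guaranteed
      gain \<open>u / 4\<close>.\<close>
    have "Z / 2 \<le> h" using h small u by linarith
    then have "Z / 2 * (u / (2 * Z)) \<le> h * (u / (2 * Z))"
      using Z u by (intro mult_right_mono) auto
    moreover have "Z / 2 * (u / (2 * Z)) = u / 4" using Z by simp
    moreover have "h * v \<le> v" using h1 v0 mult_right_mono[of h 1 v] by simp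
    ultimately show ?thesis by (simp only: right_diff_distrib)
  qed
  moreover have "(h + z) * (2 * v) \<le> 2 * (2 * v)"
    using h1 small Z u v0 by (intro mult_right_mono) auto
  moreover have "(1 - h + z) * (D_hat ?X n d + (2 * v + e + z) / (1 - h)) \<le> 2 * (2 * v) + 2 * (2 * v + e + z)"
  proof -
    have "h \<le> Z + z" using h by (simp add: abs_le_iff)
    moreover have "200 * z \<le> 1 - Z" using small by simp
    ultimately have hz: "0 < 1 - h" and "z \<le> 1 - h" using Z z0 by simp_all
    have "(1 - h + z) * D_hat ?X n d \<le> (1 - h + z) * (2 * v)"
      using D hz z0 by (intro mult_left_mono) auto
    also have "\<dots> \<le> 2 * (2 * v)"
      using h0 small Z u v0 by (intro mult_right_mono) auto
    finally have 1: "(1 - h + z) * D_hat ?X n d \<le> 2 * (2 * v)" .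
    have "(1 - h + z) / (1 - h) \<le> 2" using hz \<open>z \<le> 1 - h\<close> by (simp add: field_simps)
    then have "(1 - h + z) / (1 - h) * (2 * v + e + z) \<le> 2 * (2 * v + e + z)"
      using v0 e0 z0 by (intro mult_right_mono) auto
    with 1 show ?thesis
      unfolding distrib_left[of "1 - h + z" "D_hat ?X n d"] by simp
  qed
  \<comment> \<open>In total \<open>14 * v + 3 * z + 2 * e\<close> is subtracted from
    \<open>u / 4\<close>, at most \<open>19 * u / 100\<close>.\<close>
  moreover have "0 < l - (z + a) - b"
    if "u / 4 - 2 * v \<le> q" "a \<le> 2 * (2 * v)" "b \<le> 2 * (2 * v) + 2 * (2 * v + e + z)" "q \<le> l"
    for a b q l
    using that small(1-3) u(1) by argo
  ultimately have "0 < M_hat ?X S r n E d"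
    unfolding M_hat_def eps_L_def eps_D_def rad v_def[symmetric] z_def[symmetric] e_def[symmetric]
      h_def[symmetric] add_0_right
    using L by blast
  moreover have "D_hat ?X n d \<le> \<delta>"
  proof -
    have "(1 - Z) * \<delta> \<le> \<delta>" using Z \<open>0 < \<delta>\<close> by simp
    then show ?thesis using D small u by linarith
  qed
  ultimately show ?thesis
    using ready by (simp add: validates_def)
qed

section \<open>A data point of positive probability that meets the joint error bounds\<close>

text \<open>Rounding down to a multiple of \<open>1 / m\<close> costs at most \<open>1 / m\<close>.
  The radius is at least that, since \<open>ln (2 / \<beta>)\<close> is at least
  \<open>ln 2\<close>, hence at least 2/3 and so at least \<open>2 / m\<close> for \<open>m\<close>
  from 3 on.\<close>

lemma floor_frequency:
  fixes p \<beta> :: real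
  assumes p: "0 \<le> p" "p \<le> 1" and m: "3 \<le> m" and \<beta>: "0 < \<beta>" "\<beta> \<le> 1"
  shows "\<bar>(\<Sum>s<m. of_bool (s < nat \<lfloor>p * real m\<rfloor>)) / real m - p\<bar> \<le> sqrt (ln (2 / \<beta>) / (2 * real m))"
proof -
  define k where "k = nat \<lfloor>p * real m\<rfloor>"
  have k: "real k \<le> p * real m" "p * real m < real k + 1"
    using p by (auto simp: k_def)
  have "p * real m \<le> real m" using p by (simp add: mult_left_le_one_le)
  then have "k \<le> m" using k by linarith
  have "(\<Sum>s<m. of_bool (s < k) :: real) = real (card ({..<m} \<inter> {..<k}))"
    by (subst sum_of_bool_eq) (auto simp: lessThan_def Int_def)
  also have "{..<m} \<inter> {..<k} = {..<k}" using \<open>k \<le> m\<close> by auto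
  finally have sum: "(\<Sum>s<m. of_bool (s < k) :: real) = real k" by simp
  have "2 / real m \<le> 2 / 3" using m by (intro divide_left_mono) auto
  also have "\<dots> \<le> ln 2" by (rule ln2_ge_two_thirds)
  also have "ln 2 \<le> ln (2 / \<beta>)"
    using \<beta> by (intro ln_mono) (auto simp: pos_le_divide_eq)
  finally have "2 / real m \<le> ln (2 / \<beta>)" .
  then have "2 / real m / (2 * real m) \<le> ln (2 / \<beta>) / (2 * real m)"
    by (rule divide_right_mono) simp
  then have "(1 / real m)\<^sup>2 \<le> ln (2 / \<beta>) / (2 * real m)"
    by (simp add: power2_eq_square)
  then have "1 / real m \<le> sqrt (ln (2 / \<beta>) / (2 * real m))"
    by (rule real_le_rsqrt)
  moreover have "\<bar>real k / real m - p\<bar> \<le> 1 / real m"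
  proof -
    have "real k / real m - p = (real k - p * real m) / real m"
      using m by (simp add: diff_divide_distrib)
    moreover have "\<bar>(real k - p * real m) / real m\<bar> \<le> 1 / real m"
      unfolding abs_divide using k by (simp add: divide_right_mono)
    ultimately show ?thesis by simp
  qed
  ultimately show ?thesis
    unfolding k_def[symmetric] sum by linarith
qed

lemma fail_prob_two_task: "fail_prob (two_task Z u) t = of_bool (t = T_F)"
  by (simp add: fail_prob_def two_task_def)

lemma set_pmf_record_two_task:
  assumes "0 < Z" "Z < 1"
  shows "set_pmf (record_pmf (two_task Z u)) = {(T_F, True), (T_R, False)}"
proof -
  have "set_pmf (user_dist (two_task Z u)) = {T_F, T_R}"
    using assms by (auto simp: two_task_def set_pmf_bernoulli)
  moreover have "bernoulli_pmf (1::real) = return_pmf True" "bernoulli_pmf (0::real) = return_pmf False"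
    by (rule pmf_eqI; case_tac i; simp)+
  ultimately show ?thesis
    by (simp add: record_pmf_def fail_prob_two_task insert_commute)
qed

lemma set_pmf_agent_two_task:
  assumes "0 < Z" "0 < u" "u \<le> Z / 2"
  shows "set_pmf (agent (two_task Z u) a T_F) = UNIV"
    and "set_pmf (agent (two_task Z u) a T_R) = {True}"
proof -
  have "0 < 1 - u / Z" "1 - u / Z < 1" "0 < 1 - u / (2 * Z)" "1 - u / (2 * Z) < 1"
    using assms by (auto simp: field_simps)
  then show "set_pmf (agent (two_task Z u) a T_F) = UNIV"
    and "set_pmf (agent (two_task Z u) a T_R) = {True}"
    by (auto simp: two_task_def set_pmf_bernoulli split: side.split)
qed

lemma joint_error_bounds_possible:
  fixes E :: "('g, task, bool) design"
  assumes Z: "0 < Z" "Z < 1" and u: "0 < u" "u \<le> Z / 2"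
    and n: "3 \<le> roll_n n" "0 < fail_n n" "3 \<le> rec_n n"
    and risk: "0 < rollout_risk r n" "rollout_risk r n \<le> 1"
      "0 < risk_Z r - mixing_loss S n E" "risk_Z r - mixing_loss S n E \<le> 1"
      "0 < risk_R r - mixing_loss S n E" "risk_R r - mixing_loss S n E \<le> 1"
    and rad: "0 \<le> radius_F E"
  shows "\<exists>d\<in>set_pmf (eval_pmf (two_task Z u) n T_F).
    ready (two_task Z u) n d \<and> joint_error_bounds (two_task Z u) S r n E d"
proof -
  let ?X = "two_task Z u"
  define k where "k = nat \<lfloor>Z * real (rec_n n)\<rfloor>"
  define st where "st = map (\<lambda>j. if j < k then (T_F, True) else (T_R, False)) [0..<rec_n n]"
  define sc where "sc = replicate (fail_n n) (T_F, True)"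
  define tl where "tl = eval_tasks ?X (fail_n n) st sc"
  \<comment> \<open>Outside the index set the value must be the default of \<open>Pi_pmf\<close>, or
    the point would have mass 0.\<close>
  define \<rho> where "\<rho> = (\<lambda>(i, a, s). if i < length tl \<and> s < roll_n n
    then s < nat \<lfloor>V ?X a (tl ! i) * real (roll_n n)\<rfloor> else undefined)"
  define d where "d = \<lparr> stored = st, screened = sc, rolls = \<rho> \<rparr>"
  have d_simps [simp]: "stored d = st" "screened d = sc" "rolls d = \<rho>"
    by (simp_all add: d_def)
  have tld: "task_list ?X n d = tl"
    by (simp add: task_list_def tl_def)
  have V01: "0 \<le> V ?X a t" "V ?X a t \<le> 1" for a t
    using Z u by (cases t; cases a; simp add: V_two_task field_simps)+
  have "(0::nat) < rec_n n" using n by simp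
  \<comment> \<open>Strictness leaves the last record unmarked, so the retained set is
    nonempty.\<close>
  then have kn: "k < rec_n n"
    using Z unfolding k_def by (simp add: floor_less_iff nat_less_iff)
  have batch: "failure_batch ?X (fail_n n) sc = Some (replicate (fail_n n) T_F)"
    by (simp add: failure_batch_def sc_def two_task_def)
  have "rec_n n - 1 \<in> retained_idx n d"
    using kn by (auto simp: retained_idx_def st_def)
  then have ready: "ready ?X n d"
    using batch by (auto simp: ready_def st_def)
  have "Z_hat n d = (\<Sum>j<rec_n n. of_bool (j < k)) / real (rec_n n)"
    unfolding Z_hat_def by (intro arg_cong2[where f = "(/)"] sum.cong) (auto simp: st_def)
  then have Zh: "\<bar>Z_hat n d - failure_rate ?X\<bar> \<le> eps_Z S r n E"
    using floor_frequency[of Z "rec_n n" "risk_Z r - mixing_loss S n E"] Z u n risk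
    by (simp add: k_def eps_Z_def two_task_instance)
  have Vh: "\<bar>V_hat ?X n d a i - V ?X a (tl ! i)\<bar> \<le> eps_V r n" if "i < length tl" for a i
  proof -
    have "V_hat ?X n d a i =
        (\<Sum>s<roll_n n. of_bool (s < nat \<lfloor>V ?X a (tl ! i) * real (roll_n n)\<rfloor>)) / real (roll_n n)"
      unfolding V_hat_def
      by (intro arg_cong2[where f = "(/)"] sum.cong) (use that in \<open>auto simp: \<rho>_def two_task_def\<close>)
    then show ?thesis
      using floor_frequency[of "V ?X a (tl ! i)" "roll_n n" "rollout_risk r n"] V01 n risk
      by (simp add: eps_V_def)
  qed
  \<comment> \<open>Both sides of the retained-task deviation are 0, so that bound only asks for
    \<open>eps_R\<close> to be nonnegative.\<close>
  have "max 0 (V ?X Current t - V ?X Candidate t) = 0" for t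
    using V_two_task_le[OF Z(1) u, of t] by simp
  moreover have "0 \<le> eps_R S r n E"
    using risk by (simp add: eps_R_def)
  ultimately have joint: "joint_error_bounds ?X S r n E d"
    using Zh Vh batch rad Z u n
    by (simp add: joint_error_bounds_def tld two_task_instance batch_error_two_task)
  have "st \<in> set_pmf (replicate_pmf (rec_n n) (record_pmf ?X))"
    using Z by (auto simp: set_replicate_pmf set_pmf_record_two_task st_def)
  moreover have "sc \<in> set_pmf (map_pmf (map (Pair T_F)) (replicate_pmf (fail_n n) (agent ?X Current T_F)))"
    using Z u by (auto simp: sc_def set_replicate_pmf set_pmf_agent_two_task
        intro!: image_eqI[of _ _ "replicate (fail_n n) True"])
  moreover have "\<rho> \<in> set_pmf (rollout_pmf ?X (roll_n n) tl)"
  proof -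
    \<comment> \<open>On \<open>T_R\<close> the value is 1, so rounding makes every output
      \<open>True\<close>, the only possible one; on \<open>T_F\<close> both outputs are
      possible.\<close>
    have "\<rho> (i, a, s) \<in> set_pmf (agent ?X a (tl ! i))" if "i < length tl" "s < roll_n n" for i a s
      using that Z u by (cases "tl ! i") (auto simp: \<rho>_def set_pmf_agent_two_task V_two_task)
    then have "0 < (\<Prod>x\<in>{..<length tl} \<times> UNIV \<times> {..<roll_n n}.
        pmf ((\<lambda>(i, a, s). agent ?X a (tl ! i)) x) (\<rho> x))"
      by (intro prod_pos) (auto simp: pmf_positive_iff)
    moreover have "finite (UNIV :: side set)"
      by (rule finite_subset[of _ "{Current, Candidate}"]) (auto intro: side.exhaust)
    ultimately show ?thesis
      unfolding rollout_pmf_def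
      by (subst pmf_positive_iff[symmetric], subst pmf_Pi') (auto simp: \<rho>_def)
  qed
  ultimately have "0 < pmf (eval_pmf ?X n T_F) d"
    by (simp add: pmf_eval_pmf pmf_positive_iff tl_def)
  then show ?thesis
    using ready joint by (auto simp: pmf_positive_iff)
qed

section \<open>Choice of spacing and sample sizes\<close>

lemma sqrt_ln_radius_le:
  fixes b L c N :: real
  assumes b: "0 < b" "ln (2 / b) \<le> L" and c: "0 < c" and N: "L / (2 * c\<^sup>2) \<le> N" "0 < N"
  shows "sqrt (ln (2 / b) / (2 * N)) \<le> c"
proof -
  have "ln (2 / b) / (2 * N) \<le> c\<^sup>2"
    using b c N by (simp add: field_simps)
  then show ?thesis
    using c by (intro real_le_lsqrt) auto
qed

text \<open>The record count \<open>N\<close> is fixed first, so the spacing may depend on it and on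
  the stream without affecting the sizes.\<close>

lemma small_mixing_spacing:
  fixes \<beta> :: "nat \<Rightarrow> real"
  assumes "\<beta> \<longlonglongrightarrow> 0" "0 < e"
  obtains l where "0 < l" "2 * real N * \<beta> l < e"
proof -
  have "(\<lambda>l. 2 * real N * \<beta> l) \<longlonglongrightarrow> 2 * real N * 0"
    by (intro tendsto_intros assms)
  then have "\<forall>\<^sub>F l in sequentially. 2 * real N * \<beta> l < e"
    using assms by (auto simp: order_tendsto_iff)
  then obtain l0 where "\<And>l. l0 \<le> l \<Longrightarrow> 2 * real N * \<beta> l < e"
    by (auto simp: eventually_sequentially)
  then show ?thesis
    using that[of "Suc l0"] by simp
qed


lemma two_task_design:
  fixes G :: "'g measure" and n :: sizes
  assumes Z: "0 < Z" "Z < 1" and u: "0 < u" "u \<le> Z / 2" "u \<le> (1 - Z) * \<delta>" and \<delta>: "0 < \<delta>"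
    and r: "valid_allocation r"
    and n: "3 \<le> roll_n n" "3 \<le> rec_n n" "fail_n n = rec_n n"
    and N: "ln (4 / min (risk_Z r) (risk_R r)) / (2 * ((1 - Z) / 100 * u)\<^sup>2) \<le> real (rec_n n)"
    and m: "ln (8 * real (rec_n n) / risk_V r) / (2 * ((1 - Z) / 100 * u)\<^sup>2) \<le> real (roll_n n)"
    and S: "user_stream (user_dist (two_task Z u)) S" "beta_mixing S \<longlonglongrightarrow> 0" and G: "prob_space G"
  shows "\<exists>E :: ('g, task, bool) design.
    evaluation_design (two_task Z u) S r n G E \<and>
    0 < measure (law E) {(h, d) \<in> space (law E).
      ready (two_task Z u) n d \<and> joint_error_bounds (two_task Z u) S r n E d} \<and>
    (\<forall>(h, d) \<in> space (law E). ready (two_task Z u) n d \<longrightarrow>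
      joint_error_bounds (two_task Z u) S r n E d \<longrightarrow> validates \<delta> (two_task Z u) S r n E d)"
proof -
  let ?X = "two_task Z u"
  interpret G: prob_space G by fact
  define w where "w = min (risk_Z r) (risk_R r)"
  have w: "0 < w" "w \<le> risk_Z r" "w \<le> risk_R r" and r1: "risk_Z r \<le> 1" "risk_R r \<le> 1"
    and rF: "0 \<le> risk_F r" and rV: "0 < risk_V r" "risk_V r \<le> 1"
    using r by (auto simp: w_def valid_allocation_def)
  \<comment> \<open>Both corrected risks then exceed \<open>w / 2\<close>, which explains the 4 in
    the hypothesis on \<open>rec_n n\<close>.\<close>
  obtain l where l: "0 < l" "2 * real (rec_n n) * beta_mixing S l < w / 2"
    using small_mixing_spacing[OF S(2), of "w / 2"] w by auto
  have beta: "0 \<le> beta_mixing S l"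
    using S(1) by (rule beta_mixing_nonneg)
  define E where "E = fixed_task_design ?X n T_F l 0 G"
  have loss: "0 \<le> mixing_loss S n E" "mixing_loss S n E < w / 2"
    using l beta by (simp_all add: mixing_loss_def E_def)
  have rhoV: "0 < rollout_risk r n" "rollout_risk r n \<le> 1"
    using n rV by (simp_all add: rollout_risk_def field_simps)
  have c: "0 < (1 - Z) / 100 * u"
    using Z u by simp
  have radius: "sqrt (ln (2 / (\<beta> - mixing_loss S n E)) / (2 * real (rec_n n))) \<le> (1 - Z) / 100 * u"
    if "w \<le> \<beta>" for \<beta>
  proof (rule sqrt_ln_radius_le[OF _ _ c])
    show "0 < \<beta> - mixing_loss S n E" using loss w that by linarith
    have "2 / (\<beta> - mixing_loss S n E) \<le> 2 / (w / 2)"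
      using loss w that by (intro divide_left_mono mult_pos_pos) linarith+
    then show "ln (2 / (\<beta> - mixing_loss S n E)) \<le> ln (4 / w)"
      using loss w that by (intro ln_mono) auto
    show "ln (4 / w) / (2 * ((1 - Z) / 100 * u)\<^sup>2) \<le> real (rec_n n)"
      using N by (simp only: w_def)
    show "0 < real (rec_n n)" using n by simp
  qed
  have eZ: "eps_Z S r n E \<le> (1 - Z) / 100 * u" and eR: "eps_R S r n E \<le> (1 - Z) / 100 * u"
    using radius w by (simp_all only: eps_Z_def eps_R_def)
  \<comment> \<open>With equal task counts the union bound runs over \<open>4 * rec_n n\<close>
    reward estimates.\<close>
  have "2 / rollout_risk r n = 8 * real (rec_n n) / risk_V r"
    using n rV by (simp add: rollout_risk_def field_simps)
  then have eV: "eps_V r n \<le> (1 - Z) / 100 * u"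
    unfolding eps_V_def using m n rhoV by (intro sqrt_ln_radius_le[OF _ _ c]) auto
  have "batch_error ?X n ts \<le> 0" if "failure_batch ?X (fail_n n) sc = Some ts" for sc ts
    using failure_batch_two_task[OF that] batch_error_two_task[OF Z u(1,2), of n] n by simp
  then have "evaluation_design ?X S r n G E"
    unfolding E_def using G l beta w rF
    by (intro evaluation_design_fixed_task) (auto simp: w_def)
  moreover have "0 < measure (law E) {(h, d) \<in> space (law E).
      ready ?X n d \<and> joint_error_bounds ?X S r n E d}"
  proof -
    have "\<exists>d\<in>set_pmf (eval_pmf ?X n T_F). ready ?X n d \<and> joint_error_bounds ?X S r n E d"
      using Z u n rhoV loss w r1 by (intro joint_error_bounds_possible) (auto simp: E_def)
    then have "0 < measure_pmf.prob (eval_pmf ?X n T_F) {d. ready ?X n d \<and> joint_error_bounds ?X S r n E d}"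
      by (auto simp: zero_less_measure_iff measure_pmf_zero_iff)
    moreover have "{(h, d) \<in> space (law E). ready ?X n d \<and> joint_error_bounds ?X S r n E d} =
        space G \<times> {d. ready ?X n d \<and> joint_error_bounds ?X S r n E d}"
      by (auto simp: E_def space_pair_measure)
    ultimately show ?thesis
      by (simp add: E_def measure_pair_pmf_Times G.prob_space)
  qed
  moreover have "validates \<delta> ?X S r n E d" if "ready ?X n d" "joint_error_bounds ?X S r n E d" for d
    using that Z u \<delta> n eV eZ eR by (intro validates_two_task) (auto simp: E_def)
  ultimately show ?thesis by blast
qed

text \<open>First \<open>N\<close> is taken of order \<open>1 / u\<^sup>2\<close>; then
  \<open>ln (b * N)\<close> is at most a constant plus \<open>2 * ln (1 / u)\<close>. As
  \<open>u\<close> is at most 1/2, \<open>ln (1 / u)\<close> is at least 1/2 and absorbs the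
  constants.\<close>

lemma sample_sizes_exist:
  fixes a b c :: real
  assumes "0 < c" "0 < b"
  shows "\<exists>C. \<forall>u. 0 < u \<longrightarrow> u \<le> 1 / 2 \<longrightarrow>
    (\<exists>m N :: nat. 3 \<le> m \<and> 3 \<le> N \<and> a / (2 * (c * u)\<^sup>2) \<le> real N \<and>
      ln (b * real N) / (2 * (c * u)\<^sup>2) \<le> real m \<and>
      real N \<le> C * ln (1 / u) / u\<^sup>2 \<and> real m \<le> C * ln (1 / u) / u\<^sup>2)"
proof -
  \<comment> \<open>The summands 4 here and 8 in \<open>D\<close> pay for rounding down and force
    both sizes above 3. The 2 in front of the absolute value in \<open>B\<close> compensates for the
    lower bound 1/2 on \<open>ln (1 / u)\<close>.\<close>
  define A where "A = \<bar>a\<bar> / (2 * c\<^sup>2) + 4"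
  define B where "B = 2 * \<bar>ln (b * A)\<bar> + 2"
  define D where "D = B / (2 * c\<^sup>2) + 8"
  have pos: "0 < A" "0 < B" "0 < D"
    using assms by (auto simp: A_def B_def D_def intro!: add_nonneg_pos)
  have "\<exists>m N :: nat. 3 \<le> m \<and> 3 \<le> N \<and> a / (2 * (c * u)\<^sup>2) \<le> real N \<and>
      ln (b * real N) / (2 * (c * u)\<^sup>2) \<le> real m \<and>
      real N \<le> (2 * A + D) * ln (1 / u) / u\<^sup>2 \<and> real m \<le> (2 * A + D) * ln (1 / u) / u\<^sup>2"
    if u: "0 < u" "u \<le> 1 / 2" for u
  proof -
    have "u * u \<le> 1 / 2 * (1 / 2)" using u by (intro mult_mono) auto
    then have q: "4 \<le> 1 / u\<^sup>2" using u by (simp add: power2_eq_square pos_le_divide_eq)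
    have "1 / 2 \<le> ln (2::real)" using ln2_ge_two_thirds by simp
    also have "ln 2 \<le> ln (1 / u)" using u by (intro ln_mono) (auto simp: pos_le_divide_eq)
    finally have t: "1 / 2 \<le> ln (1 / u)" .
    define N where "N = nat \<lfloor>A / u\<^sup>2\<rfloor>"
    have "A * 4 \<le> A * (1 / u\<^sup>2)" using q pos by (intro mult_left_mono) auto
    then have A4: "4 * A \<le> A / u\<^sup>2" by simp
    have "4 \<le> A" using assms by (simp add: A_def)
    have N: "real N \<le> A / u\<^sup>2" "A / u\<^sup>2 - 1 < real N"
      using pos by (auto simp: N_def)
    have "A / u\<^sup>2 = \<bar>a\<bar> / (2 * c\<^sup>2) / u\<^sup>2 + 4 * (1 / u\<^sup>2)"
      by (simp add: A_def add_divide_distrib)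
    then have N1: "\<bar>a\<bar> / (2 * c\<^sup>2) / u\<^sup>2 \<le> real N" using N q by linarith
    have "a / (2 * (c * u)\<^sup>2) \<le> \<bar>a\<bar> / (2 * (c * u)\<^sup>2)"
      by (intro divide_right_mono) auto
    also have "\<dots> = \<bar>a\<bar> / (2 * c\<^sup>2) / u\<^sup>2" by (simp add: power_mult_distrib)
    finally have N2: "a / (2 * (c * u)\<^sup>2) \<le> real N" using N1 by linarith
    have N3: "3 < real N" using N A4 \<open>4 \<le> A\<close> by linarith
    have "b * real N \<le> b * (A / u\<^sup>2)"
      using N assms by (intro mult_left_mono) auto
    then have "ln (b * real N) \<le> ln (b * A * (1 / u)\<^sup>2)"
      using N3 assms by (intro ln_mono) (auto simp: power_divide)
    also have "\<dots> = ln (b * A) + 2 * ln (1 / u)"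
      using assms pos u by (subst ln_mult) (auto simp: ln_realpow)
    also have "\<dots> \<le> B * ln (1 / u)"
    proof -
      have "\<bar>ln (b * A)\<bar> * 1 \<le> \<bar>ln (b * A)\<bar> * (2 * ln (1 / u))"
        using t by (intro mult_left_mono) auto
      moreover have "B * ln (1 / u) = \<bar>ln (b * A)\<bar> * (2 * ln (1 / u)) + 2 * ln (1 / u)"
        by (simp only: B_def distrib_right mult.assoc mult.left_commute)
      ultimately show ?thesis by linarith
    qed
    finally have lnN: "ln (b * real N) \<le> B * ln (1 / u)" .
    define m where "m = nat \<lfloor>D * ln (1 / u) / u\<^sup>2\<rfloor>"
    have m: "real m \<le> D * ln (1 / u) / u\<^sup>2" "D * ln (1 / u) / u\<^sup>2 - 1 < real m"
      using pos t by (auto simp: m_def)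
    have Deq: "D * ln (1 / u) / u\<^sup>2 = B * ln (1 / u) / (2 * (c * u)\<^sup>2) + 8 * (ln (1 / u) * (1 / u\<^sup>2))"
      by (simp add: D_def distrib_right add_divide_distrib power_mult_distrib)
    have "1 / 2 * 4 \<le> ln (1 / u) * (1 / u\<^sup>2)" using t q by (intro mult_mono) auto
    moreover have "0 \<le> B * ln (1 / u) / (2 * (c * u)\<^sup>2)"
      using pos t by simp
    ultimately have m1: "3 < real m" and "B * ln (1 / u) / (2 * (c * u)\<^sup>2) \<le> real m"
      using m Deq by linarith+
    moreover have "ln (b * real N) / (2 * (c * u)\<^sup>2) \<le> B * ln (1 / u) / (2 * (c * u)\<^sup>2)"
      using lnN by (intro divide_right_mono) auto
    ultimately have m2: "ln (b * real N) / (2 * (c * u)\<^sup>2) \<le> real m" by linarith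
    have sum: "(2 * A + D) * ln (1 / u) / u\<^sup>2 = A * (2 * ln (1 / u)) / u\<^sup>2 + D * ln (1 / u) / u\<^sup>2"
      by (simp add: distrib_right add_divide_distrib)
    have "A * 1 / u\<^sup>2 \<le> A * (2 * ln (1 / u)) / u\<^sup>2"
      using pos t by (intro divide_right_mono mult_left_mono) auto
    moreover have "0 \<le> D * ln (1 / u) / u\<^sup>2" "0 \<le> A * (2 * ln (1 / u)) / u\<^sup>2"
      using pos t by simp_all
    ultimately have "real N \<le> (2 * A + D) * ln (1 / u) / u\<^sup>2" "real m \<le> (2 * A + D) * ln (1 / u) / u\<^sup>2"
      using N m sum by linarith+
    moreover have "3 \<le> m" "3 \<le> N" using m1 N3 by linarith+
    ultimately show ?thesis using N2 m2 by blast
  qed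
  then show ?thesis by blast
qed

text \<open>The quantifier order carries the claim: \<open>C\<close> and \<open>p\<close> depend
  only on \<open>Z\<close> and the risks, the sizes are chosen before stream and generation law, and
  only the design comes after these. The positive probability keeps the validation claim from being
  vacuous.\<close>

theorem proposition20:
  fixes Z :: real and r :: allocation
  assumes "0 < Z" and "Z < 1" and "valid_allocation r"
  shows "\<exists>(C::real) (p::nat). \<forall>(\<delta>::real) (u::real). 0 < \<delta> \<longrightarrow> 0 < u \<longrightarrow> u \<le> min (Z / 2) ((1 - Z) * \<delta>) \<longrightarrow>
    (let X = two_task Z u; g = remaining_gap X in
     \<exists>n :: sizes.
       (\<forall>k \<in> {roll_n n, fail_n n, rec_n n}. 0 < k \<and> real k \<le> C * ln (1 / g) ^ p / g\<^sup>2) \<and>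
       (\<forall>(S :: (nat \<Rightarrow> task) measure) (G :: 'g measure).
          user_stream (user_dist X) S \<longrightarrow> beta_mixing S \<longlonglongrightarrow> 0 \<longrightarrow> prob_space G \<longrightarrow>
          (\<exists>E :: ('g, task, bool) design.
             evaluation_design X S r n G E \<and>
             0 < measure (law E) {(h, d) \<in> space (law E). ready X n d \<and> joint_error_bounds X S r n E d} \<and>
             (\<forall>(h, d) \<in> space (law E).
                ready X n d \<longrightarrow> joint_error_bounds X S r n E d \<longrightarrow> validates \<delta> X S r n E d))))"
proof -
  have "0 < (1 - Z) / 100" "0 < 8 / risk_V r"
    using assms by (auto simp: valid_allocation_def)
  from sample_sizes_exist[OF this, of "ln (4 / min (risk_Z r) (risk_R r))"]
  obtain C where C: "\<And>u. 0 < u \<Longrightarrow> u \<le> 1 / 2 \<Longrightarrow> \<exists>m N :: nat. 3 \<le> m \<and> 3 \<le> N \<and>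
      ln (4 / min (risk_Z r) (risk_R r)) / (2 * ((1 - Z) / 100 * u)\<^sup>2) \<le> real N \<and>
      ln (8 / risk_V r * real N) / (2 * ((1 - Z) / 100 * u)\<^sup>2) \<le> real m \<and>
      real N \<le> C * ln (1 / u) / u\<^sup>2 \<and> real m \<le> C * ln (1 / u) / u\<^sup>2"
    by blast
  show ?thesis
  \<comment> \<open>One logarithm suffices, coming from the union bound in the rollout
    count.\<close>
  proof (intro exI[of _ C] exI[of _ 1] allI impI)
    fix \<delta> u :: real
    assume \<delta>: "0 < \<delta>" and u: "0 < u" "u \<le> min (Z / 2) ((1 - Z) * \<delta>)"
    have gap: "remaining_gap (two_task Z u) = u"
      using two_task_instance(2)[of Z u] assms u by simp
    have "u \<le> 1 / 2" using u assms by simp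
    with C[OF u(1)] obtain m N :: nat where mN: "3 \<le> m" "3 \<le> N"
      "ln (4 / min (risk_Z r) (risk_R r)) / (2 * ((1 - Z) / 100 * u)\<^sup>2) \<le> real N"
      "ln (8 / risk_V r * real N) / (2 * ((1 - Z) / 100 * u)\<^sup>2) \<le> real m"
      "real N \<le> C * ln (1 / u) / u\<^sup>2" "real m \<le> C * ln (1 / u) / u\<^sup>2"
      by blast
    define n where "n = \<lparr> roll_n = m, fail_n = N, rec_n = N \<rparr>"
    have n: "roll_n n = m" "fail_n n = N" "rec_n n = N"
      by (simp_all add: n_def)
    have m: "ln (8 * real N / risk_V r) / (2 * ((1 - Z) / 100 * u)\<^sup>2) \<le> real m"
      using mN(4) by simp
    have size: "\<forall>k \<in> {roll_n n, fail_n n, rec_n n}. 0 < k \<and> real k \<le> C * ln (1 / u) ^ 1 / u\<^sup>2"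
      using mN n by auto
    have u': "u \<le> Z / 2" "u \<le> (1 - Z) * \<delta>" using u by simp_all
    show "let X = two_task Z u; g = remaining_gap X in
     \<exists>n :: sizes.
       (\<forall>k \<in> {roll_n n, fail_n n, rec_n n}. 0 < k \<and> real k \<le> C * ln (1 / g) ^ 1 / g\<^sup>2) \<and>
       (\<forall>(S :: (nat \<Rightarrow> task) measure) (G :: 'g measure).
          user_stream (user_dist X) S \<longrightarrow> beta_mixing S \<longlonglongrightarrow> 0 \<longrightarrow> prob_space G \<longrightarrow>
          (\<exists>E :: ('g, task, bool) design.
             evaluation_design X S r n G E \<and>
             0 < measure (law E) {(h, d) \<in> space (law E). ready X n d \<and> joint_error_bounds X S r n E d} \<and>
             (\<forall>(h, d) \<in> space (law E).
                ready X n d \<longrightarrow> joint_error_bounds X S r n E d \<longrightarrow> validates \<delta> X S r n E d)))"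
      unfolding Let_def gap
      by (intro exI[of _ n] conjI allI impI size two_task_design[OF assms(1,2) u(1) u' \<delta> assms(3)])
        (simp_all only: n mN m)
  qed
qed

end
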